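(* Let $T$ be a ternary $\Gamma$-semiring, let $f,g:M\to N$ be morphisms in $\mathsf{SMod}_{T,\Gamma}$, and let $\equiv_{f,g}$ be the congruence on the semimodule $N$ generated by the set of pairs $\{(f(m),g(m))\mid m\in M\}$. Then the canonical projection $q:N\to N/{\equiv_{f,g}}$ is a coequalizer of $f$ and $g$ in $\mathsf{SMod}_{T,\Gamma}$.
   Context: Fix a commutative monoid $(\Gamma,+,0_\Gamma)$. A ternary $\Gamma$-semiring is a commutative monoid $(T,+,0)$ with a map $T\times\Gamma\times T\times\Gamma\times T\to T$, $(a,\alpha,b,\beta,c)\mapsto a\alpha b\beta c$, that is additive in each of the five slots separately, satisfies ternary associativity $(a\alpha b\beta c)\gamma d\delta e=a\alpha(b\beta c\gamma d)\delta e=a\alpha b\beta(c\gamma d\delta e)$ for all $a,b,c,d,e\in T$, $\alpha,\beta,\gamma,\delta\in\Gamma$, and satisfies $a\alpha b\beta c=0$ whenever one of $a,b,c$ is $0$ or one of $\alpha,\beta$ is $0_\Gamma$. A ternary $\Gamma$-semimodule over $T$ is a commutative monoid $(M,+,0)$ with a map $T\times\Gamma\times M\times\Gamma\times T\to M$, $(a,\alpha,m,\beta,b)\mapsto a\alpha m\beta b$, that is additive in each of the five slots separately, satisfies $a\alpha m\beta b=0$ whenever $a=0$ or $m=0$ or $b=0$ or $\alpha=0_\Gamma$ or $\beta=0_\Gamma$, and satisfies $(a\alpha b\beta c)\gamma m\delta d=a\alpha(b\beta m\gamma c)\delta d$ for all $a,b,c,d\in T$, $m\in M$, $\alpha,\beta,\gamma,\delta\in\Gamma$.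 A morphism $f:M\to N$ is a monoid morphism with $f(a\alpha m\beta b)=a\alpha f(m)\beta b$ for all $a,b\in T$, $\alpha,\beta\in\Gamma$, $m\in M$. The resulting category is $\mathsf{SMod}_{T,\Gamma}$. A congruence on a semimodule $M$ is an equivalence relation $\equiv$ such that $x\equiv y$ implies $x+z\equiv y+z$ for all $z\in M$ and $a\alpha x\beta b\equiv a\alpha y\beta b$ for all $a,b\in T$, $\alpha,\beta\in\Gamma$. The quotient set $M/{\equiv}$ is a ternary $\Gamma$-semimodule with the operations induced from $M$. The congruence generated by a set of pairs is the smallest congruence containing it. *)

theory Defs
  imports "HOL-Algebra.Group"
begin

text \<open>
  Commutative monoids are those of HOL-Algebra; the following notation only lets their
  operation and neutral element be written additively.
\<close>

abbreviation madd :: "('a, 'b) monoid_scheme \<Rightarrow> 'a \<Rightarrow> 'a \<Rightarrow> 'a"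
    (infixl \<open>\<boxplus>\<index>\<close> 65)
  where "x \<boxplus>\<^bsub>G\<^esub> y \<equiv> x \<otimes>\<^bsub>G\<^esub> y"

abbreviation mzero :: "('a, 'b) monoid_scheme \<Rightarrow> 'a"
    (\<open>\<zero>\<^sub>m\<index>\<close>)
  where "\<zero>\<^sub>m\<^bsub>G\<^esub> \<equiv> \<one>\<^bsub>G\<^esub>"


text \<open>\<open>tern T a \<alpha> b \<beta> c\<close> is the ternary product a\<alpha>b\<beta>c.\<close>

record ('t, 'g) tg_semiring = "'t monoid" +
  tern :: "'t \<Rightarrow> 'g \<Rightarrow> 't \<Rightarrow> 'g \<Rightarrow> 't \<Rightarrow> 't"

locale ternary_gamma_semiring =
  \<Gamma>: comm_monoid \<Gamma> + T: comm_monoid T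
  for \<Gamma> :: "'g monoid" and T :: "('t, 'g) tg_semiring" +
  assumes tern_closed:
    "\<lbrakk>a \<in> carrier T; \<alpha> \<in> carrier \<Gamma>; b \<in> carrier T; \<beta> \<in> carrier \<Gamma>; c \<in> carrier T\<rbrakk>
      \<Longrightarrow> tern T a \<alpha> b \<beta> c \<in> carrier T"
  and tern_add1:
    "\<lbrakk>a \<in> carrier T; a' \<in> carrier T; \<alpha> \<in> carrier \<Gamma>; b \<in> carrier T; \<beta> \<in> carrier \<Gamma>; c \<in> carrier T\<rbrakk>
      \<Longrightarrow> tern T (a \<boxplus>\<^bsub>T\<^esub> a') \<alpha> b \<beta> c = tern T a \<alpha> b \<beta> c \<boxplus>\<^bsub>T\<^esub> tern T a' \<alpha> b \<beta> c"
  and tern_add2: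
    "\<lbrakk>a \<in> carrier T; \<alpha> \<in> carrier \<Gamma>; \<alpha>' \<in> carrier \<Gamma>; b \<in> carrier T; \<beta> \<in> carrier \<Gamma>; c \<in> carrier T\<rbrakk>
      \<Longrightarrow> tern T a (\<alpha> \<boxplus>\<^bsub>\<Gamma>\<^esub> \<alpha>') b \<beta> c = tern T a \<alpha> b \<beta> c \<boxplus>\<^bsub>T\<^esub> tern T a \<alpha>' b \<beta> c"
  and tern_add3:
    "\<lbrakk>a \<in> carrier T; \<alpha> \<in> carrier \<Gamma>; b \<in> carrier T; b' \<in> carrier T; \<beta> \<in> carrier \<Gamma>; c \<in> carrier T\<rbrakk>
      \<Longrightarrow> tern T a \<alpha> (b \<boxplus>\<^bsub>T\<^esub> b') \<beta> c = tern T a \<alpha> b \<beta> c \<boxplus>\<^bsub>T\<^esub> tern T a \<alpha> b' \<beta> c"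
  and tern_add4:
    "\<lbrakk>a \<in> carrier T; \<alpha> \<in> carrier \<Gamma>; b \<in> carrier T; \<beta> \<in> carrier \<Gamma>; \<beta>' \<in> carrier \<Gamma>; c \<in> carrier T\<rbrakk>
      \<Longrightarrow> tern T a \<alpha> b (\<beta> \<boxplus>\<^bsub>\<Gamma>\<^esub> \<beta>') c = tern T a \<alpha> b \<beta> c \<boxplus>\<^bsub>T\<^esub> tern T a \<alpha> b \<beta>' c"
  and tern_add5:
    "\<lbrakk>a \<in> carrier T; \<alpha> \<in> carrier \<Gamma>; b \<in> carrier T; \<beta> \<in> carrier \<Gamma>; c \<in> carrier T; c' \<in> carrier T\<rbrakk>
      \<Longrightarrow> tern T a \<alpha> b \<beta> (c \<boxplus>\<^bsub>T\<^esub> c') = tern T a \<alpha> b \<beta> c \<boxplus>\<^bsub>T\<^esub> tern T a \<alpha> b \<beta> c'"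
  and tern_assoc_left:
    "\<lbrakk>a \<in> carrier T; b \<in> carrier T; c \<in> carrier T; d \<in> carrier T; e \<in> carrier T;
      \<alpha> \<in> carrier \<Gamma>; \<beta> \<in> carrier \<Gamma>; \<gamma> \<in> carrier \<Gamma>; \<delta> \<in> carrier \<Gamma>\<rbrakk>
      \<Longrightarrow> tern T (tern T a \<alpha> b \<beta> c) \<gamma> d \<delta> e = tern T a \<alpha> (tern T b \<beta> c \<gamma> d) \<delta> e"
  and tern_assoc_right:
    "\<lbrakk>a \<in> carrier T; b \<in> carrier T; c \<in> carrier T; d \<in> carrier T; e \<in> carrier T;
      \<alpha> \<in> carrier \<Gamma>; \<beta> \<in> carrier \<Gamma>; \<gamma> \<in> carrier \<Gamma>; \<delta> \<in> carrier \<Gamma>\<rbrakk>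
      \<Longrightarrow> tern T a \<alpha> (tern T b \<beta> c \<gamma> d) \<delta> e = tern T a \<alpha> b \<beta> (tern T c \<gamma> d \<delta> e)"
  and tern_zero:
    "\<lbrakk>a \<in> carrier T; \<alpha> \<in> carrier \<Gamma>; b \<in> carrier T; \<beta> \<in> carrier \<Gamma>; c \<in> carrier T;
      a = \<zero>\<^sub>m\<^bsub>T\<^esub> \<or> b = \<zero>\<^sub>m\<^bsub>T\<^esub> \<or> c = \<zero>\<^sub>m\<^bsub>T\<^esub> \<or> \<alpha> = \<zero>\<^sub>m\<^bsub>\<Gamma>\<^esub> \<or> \<beta> = \<zero>\<^sub>m\<^bsub>\<Gamma>\<^esub>\<rbrakk>
      \<Longrightarrow> tern T a \<alpha> b \<beta> c = \<zero>\<^sub>m\<^bsub>T\<^esub>"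


text \<open>\<open>act M a \<alpha> m \<beta> b\<close> is the two-sided action a\<alpha>m\<beta>b.\<close>

record ('t, 'g, 'm) tg_semimodule = "'m monoid" +
  act :: "'t \<Rightarrow> 'g \<Rightarrow> 'm \<Rightarrow> 'g \<Rightarrow> 't \<Rightarrow> 'm"

locale ternary_gamma_semimodule =
  ternary_gamma_semiring \<Gamma> T + M: comm_monoid M
  for \<Gamma> :: "'g monoid" and T :: "('t, 'g) tg_semiring" and M :: "('t, 'g, 'm) tg_semimodule" +
  assumes act_closed:
    "\<lbrakk>a \<in> carrier T; \<alpha> \<in> carrier \<Gamma>; m \<in> carrier M; \<beta> \<in> carrier \<Gamma>; b \<in> carrier T\<rbrakk>
      \<Longrightarrow> act M a \<alpha> m \<beta> b \<in> carrier M"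
  and act_add1:
    "\<lbrakk>a \<in> carrier T; a' \<in> carrier T; \<alpha> \<in> carrier \<Gamma>; m \<in> carrier M; \<beta> \<in> carrier \<Gamma>; b \<in> carrier T\<rbrakk>
      \<Longrightarrow> act M (a \<boxplus>\<^bsub>T\<^esub> a') \<alpha> m \<beta> b = act M a \<alpha> m \<beta> b \<boxplus>\<^bsub>M\<^esub> act M a' \<alpha> m \<beta> b"
  and act_add2:
    "\<lbrakk>a \<in> carrier T; \<alpha> \<in> carrier \<Gamma>; \<alpha>' \<in> carrier \<Gamma>; m \<in> carrier M; \<beta> \<in> carrier \<Gamma>; b \<in> carrier T\<rbrakk>
      \<Longrightarrow> act M a (\<alpha> \<boxplus>\<^bsub>\<Gamma>\<^esub> \<alpha>') m \<beta> b = act M a \<alpha> m \<beta> b \<boxplus>\<^bsub>M\<^esub> act M a \<alpha>' m \<beta> b"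
  and act_add3:
    "\<lbrakk>a \<in> carrier T; \<alpha> \<in> carrier \<Gamma>; m \<in> carrier M; m' \<in> carrier M; \<beta> \<in> carrier \<Gamma>; b \<in> carrier T\<rbrakk>
      \<Longrightarrow> act M a \<alpha> (m \<boxplus>\<^bsub>M\<^esub> m') \<beta> b = act M a \<alpha> m \<beta> b \<boxplus>\<^bsub>M\<^esub> act M a \<alpha> m' \<beta> b"
  and act_add4:
    "\<lbrakk>a \<in> carrier T; \<alpha> \<in> carrier \<Gamma>; m \<in> carrier M; \<beta> \<in> carrier \<Gamma>; \<beta>' \<in> carrier \<Gamma>; b \<in> carrier T\<rbrakk>
      \<Longrightarrow> act M a \<alpha> m (\<beta> \<boxplus>\<^bsub>\<Gamma>\<^esub> \<beta>') b = act M a \<alpha> m \<beta> b \<boxplus>\<^bsub>M\<^esub> act M a \<alpha> m \<beta>' b"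
  and act_add5:
    "\<lbrakk>a \<in> carrier T; \<alpha> \<in> carrier \<Gamma>; m \<in> carrier M; \<beta> \<in> carrier \<Gamma>; b \<in> carrier T; b' \<in> carrier T\<rbrakk>
      \<Longrightarrow> act M a \<alpha> m \<beta> (b \<boxplus>\<^bsub>T\<^esub> b') = act M a \<alpha> m \<beta> b \<boxplus>\<^bsub>M\<^esub> act M a \<alpha> m \<beta> b'"
  and act_zero:
    "\<lbrakk>a \<in> carrier T; \<alpha> \<in> carrier \<Gamma>; m \<in> carrier M; \<beta> \<in> carrier \<Gamma>; b \<in> carrier T;
      a = \<zero>\<^sub>m\<^bsub>T\<^esub> \<or> m = \<zero>\<^sub>m\<^bsub>M\<^esub> \<or> b = \<zero>\<^sub>m\<^bsub>T\<^esub> \<or> \<alpha> = \<zero>\<^sub>m\<^bsub>\<Gamma>\<^esub> \<or> \<beta> = \<zero>\<^sub>m\<^bsub>\<Gamma>\<^esub>\<rbrakk>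
      \<Longrightarrow> act M a \<alpha> m \<beta> b = \<zero>\<^sub>m\<^bsub>M\<^esub>"
  and act_assoc:
    "\<lbrakk>a \<in> carrier T; b \<in> carrier T; c \<in> carrier T; d \<in> carrier T; m \<in> carrier M;
      \<alpha> \<in> carrier \<Gamma>; \<beta> \<in> carrier \<Gamma>; \<gamma> \<in> carrier \<Gamma>; \<delta> \<in> carrier \<Gamma>\<rbrakk>
      \<Longrightarrow> act M (tern T a \<alpha> b \<beta> c) \<gamma> m \<delta> d = act M a \<alpha> (act M b \<beta> m \<gamma> c) \<delta> d"


text \<open>
  Morphisms are taken in the extensional function space, so that a morphism is determined by
  its values on the carrier and equality of morphisms is plain equality; composition is
  accordingly \<open>compose\<close>, the composition restricted to the carrier of the domain.
\<close>

definition smod_hom ::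
  "'g monoid \<Rightarrow> ('t, 'g) tg_semiring \<Rightarrow> ('t, 'g, 'm) tg_semimodule \<Rightarrow> ('t, 'g, 'n) tg_semimodule
    \<Rightarrow> ('m \<Rightarrow> 'n) set"
  where "smod_hom \<Gamma> T M N =
    {f \<in> hom M N \<inter> extensional (carrier M).
      f \<zero>\<^sub>m\<^bsub>M\<^esub> = \<zero>\<^sub>m\<^bsub>N\<^esub> \<and>
      (\<forall>a\<in>carrier T. \<forall>\<alpha>\<in>carrier \<Gamma>. \<forall>m\<in>carrier M. \<forall>\<beta>\<in>carrier \<Gamma>. \<forall>b\<in>carrier T.
        f (act M a \<alpha> m \<beta> b) = act N a \<alpha> (f m) \<beta> b)}"

definition smod_congruence ::
  "'g monoid \<Rightarrow> ('t, 'g) tg_semiring \<Rightarrow> ('t, 'g, 'm) tg_semimodule \<Rightarrow> ('m \<times> 'm) set \<Rightarrow> bool"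
  where "smod_congruence \<Gamma> T M r \<longleftrightarrow>
    equiv (carrier M) r \<and>
    (\<forall>x y. (x, y) \<in> r \<longrightarrow>
      (\<forall>z\<in>carrier M. (x \<boxplus>\<^bsub>M\<^esub> z, y \<boxplus>\<^bsub>M\<^esub> z) \<in> r) \<and>
      (\<forall>a\<in>carrier T. \<forall>\<alpha>\<in>carrier \<Gamma>. \<forall>\<beta>\<in>carrier \<Gamma>. \<forall>b\<in>carrier T.
        (act M a \<alpha> x \<beta> b, act M a \<alpha> y \<beta> b) \<in> r))"

definition generated_congruence ::
  "'g monoid \<Rightarrow> ('t, 'g) tg_semiring \<Rightarrow> ('t, 'g, 'm) tg_semimodule \<Rightarrow> ('m \<times> 'm) set \<Rightarrow> ('m \<times> 'm) set"
  where "generated_congruence \<Gamma> T M R = \<Inter>{r. smod_congruence \<Gamma> T M r \<and> R \<subseteq> r}"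

text \<open>
  The induced operations are written as unions over all representatives; for a congruence the
  sets being united coincide.
\<close>

definition quotient_smod ::
  "('t, 'g, 'm) tg_semimodule \<Rightarrow> ('m \<times> 'm) set \<Rightarrow> ('t, 'g, 'm set) tg_semimodule"
  where "quotient_smod M r =
    \<lparr>carrier = carrier M // r,
     mult = (\<lambda>X Y. \<Union>x\<in>X. \<Union>y\<in>Y. r `` {x \<boxplus>\<^bsub>M\<^esub> y}),
     one = r `` {\<zero>\<^sub>m\<^bsub>M\<^esub>},
     act = (\<lambda>a \<alpha> X \<beta> b. \<Union>x\<in>X. r `` {act M a \<alpha> x \<beta> b})\<rparr>"

definition quotient_proj ::
  "('t, 'g, 'm) tg_semimodule \<Rightarrow> ('m \<times> 'm) set \<Rightarrow> 'm \<Rightarrow> 'm set"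
  where "quotient_proj M r = (\<lambda>x\<in>carrier M. r `` {x})"

text \<open>
  A definition cannot quantify over types, so the carrier type \<open>'p\<close> of the test objects P is a
  parameter. The full universal property is the statement for a type variable \<open>'p\<close>.
\<close>

definition is_coequalizer ::
  "'p itself \<Rightarrow> 'g monoid \<Rightarrow> ('t, 'g) tg_semiring
    \<Rightarrow> ('t, 'g, 'm) tg_semimodule \<Rightarrow> ('t, 'g, 'n) tg_semimodule \<Rightarrow> ('m \<Rightarrow> 'n) \<Rightarrow> ('m \<Rightarrow> 'n)
    \<Rightarrow> ('t, 'g, 'q) tg_semimodule \<Rightarrow> ('n \<Rightarrow> 'q) \<Rightarrow> bool"
  where "is_coequalizer (_ :: 'p itself) \<Gamma> T M N f g Q q \<longleftrightarrow>
    ternary_gamma_semimodule \<Gamma> T Q \<and>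
    q \<in> smod_hom \<Gamma> T N Q \<and>
    compose (carrier M) q f = compose (carrier M) q g \<and>
    (\<forall>(P :: ('t, 'g, 'p) tg_semimodule) h.
      ternary_gamma_semimodule \<Gamma> T P \<and> h \<in> smod_hom \<Gamma> T N P \<and>
      compose (carrier M) h f = compose (carrier M) h g \<longrightarrow>
      (\<exists>!u. u \<in> smod_hom \<Gamma> T Q P \<and> compose (carrier N) u q = h))"

end

theory Submission
  imports Defs
begin

text \<open>
  A morphism \<open>h\<close> out of \<open>N\<close> coequalizes \<open>f\<close> and \<open>g\<close> iff its kernel relation, which is a
  congruence, contains all pairs \<open>(f m, g m)\<close>. Hence it contains the congruence they generate, and
  \<open>h\<close> factors through the quotient; the factorization is unique because the projection is onto.
\<close>

lemma smod_homI:
  assumes "h \<in> extensional (carrier M)"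
    and "\<And>x. x \<in> carrier M \<Longrightarrow> h x \<in> carrier N"
    and "\<And>x y. \<lbrakk>x \<in> carrier M; y \<in> carrier M\<rbrakk> \<Longrightarrow> h (x \<boxplus>\<^bsub>M\<^esub> y) = h x \<boxplus>\<^bsub>N\<^esub> h y"
    and "h \<zero>\<^sub>m\<^bsub>M\<^esub> = \<zero>\<^sub>m\<^bsub>N\<^esub>"
    and "\<And>a \<alpha> m \<beta> b. \<lbrakk>a \<in> carrier T; \<alpha> \<in> carrier \<Gamma>; m \<in> carrier M; \<beta> \<in> carrier \<Gamma>; b \<in> carrier T\<rbrakk>
      \<Longrightarrow> h (act M a \<alpha> m \<beta> b) = act N a \<alpha> (h m) \<beta> b"
  shows "h \<in> smod_hom \<Gamma> T M N"
  using assms by (auto simp: smod_hom_def hom_def)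

lemma smod_homD:
  assumes "h \<in> smod_hom \<Gamma> T M N"
  shows smod_hom_ext: "h \<in> extensional (carrier M)"
    and smod_hom_closed: "x \<in> carrier M \<Longrightarrow> h x \<in> carrier N"
    and smod_hom_add: "\<lbrakk>x \<in> carrier M; y \<in> carrier M\<rbrakk> \<Longrightarrow> h (x \<boxplus>\<^bsub>M\<^esub> y) = h x \<boxplus>\<^bsub>N\<^esub> h y"
    and smod_hom_zero: "h \<zero>\<^sub>m\<^bsub>M\<^esub> = \<zero>\<^sub>m\<^bsub>N\<^esub>"
    and smod_hom_act: "\<lbrakk>a \<in> carrier T; \<alpha> \<in> carrier \<Gamma>; x \<in> carrier M; \<beta> \<in> carrier \<Gamma>; b \<in> carrier T\<rbrakk>
      \<Longrightarrow> h (act M a \<alpha> x \<beta> b) = act N a \<alpha> (h x) \<beta> b"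
  using assms by (auto simp: smod_hom_def hom_def)

lemma smod_congruenceD:
  assumes "smod_congruence \<Gamma> T M r"
  shows smod_congruence_equiv: "equiv (carrier M) r"
    and smod_congruence_add: "\<lbrakk>(x, y) \<in> r; z \<in> carrier M\<rbrakk> \<Longrightarrow> (x \<boxplus>\<^bsub>M\<^esub> z, y \<boxplus>\<^bsub>M\<^esub> z) \<in> r"
    and smod_congruence_act: "\<lbrakk>(x, y) \<in> r; a \<in> carrier T; \<alpha> \<in> carrier \<Gamma>; \<beta> \<in> carrier \<Gamma>; b \<in> carrier T\<rbrakk>
      \<Longrightarrow> (act M a \<alpha> x \<beta> b, act M a \<alpha> y \<beta> b) \<in> r"
  using assms by (auto simp: smod_congruence_def)

lemma generated_congruence_least:
  assumes "smod_congruence \<Gamma> T M s" "R \<subseteq> s"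
  shows "generated_congruence \<Gamma> T M R \<subseteq> s"
  using assms by (auto simp: generated_congruence_def)

lemma generated_congruence_superset: "R \<subseteq> generated_congruence \<Gamma> T M R"
  by (auto simp: generated_congruence_def)

context ternary_gamma_semimodule
begin

lemma smod_congruence_kernel:
  assumes "h \<in> smod_hom \<Gamma> T M P"
  shows "smod_congruence \<Gamma> T M {(x, y). x \<in> carrier M \<and> y \<in> carrier M \<and> h x = h y}"
  unfolding smod_congruence_def equiv_def
  by (auto simp: refl_on_def sym_def trans_def act_closed
      smod_hom_add[OF assms] smod_hom_act[OF assms])

text \<open>Every clause of \<open>smod_congruence\<close> passes to intersections, except that the
  relation must stay inside \<open>carrier M \<times> carrier M\<close>. This is where nonemptiness
  of \<open>S\<close> enters: the empty intersection is \<open>UNIV\<close>.\<close>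

lemma smod_congruence_Inter:
  assumes "S \<noteq> {}" "\<And>r. r \<in> S \<Longrightarrow> smod_congruence \<Gamma> T M r"
  shows "smod_congruence \<Gamma> T M (\<Inter>S)"
proof -
  have eq: "equiv (carrier M) r" if "r \<in> S" for r
    using assms(2)[OF that] by (rule smod_congruence_equiv)
  have "equiv (carrier M) (\<Inter>S)"
  proof (rule equivI)
    show "\<Inter>S \<subseteq> carrier M \<times> carrier M"
      using assms(1) eq by (auto dest!: equiv_type)
    show "refl_on (carrier M) (\<Inter>S)"
      using eq by (auto simp: equiv_def refl_on_def)
    show "sym (\<Inter>S)"
      using eq by (auto simp: equiv_def intro!: symI dest: symD)
    show "trans (\<Inter>S)"
      using eq by (intro transI) (meson InterE InterI equiv_def transD)
  qed
  then show ?thesis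
    using smod_congruence_add[OF assms(2)] smod_congruence_act[OF assms(2)]
    by (auto simp: smod_congruence_def)
qed

text \<open>The largest congruence. It contains every relation on the carrier, so the family whose
  intersection defines a generated congruence is nonempty.\<close>

lemma smod_congruence_full: "smod_congruence \<Gamma> T M (carrier M \<times> carrier M)"
  unfolding smod_congruence_def equiv_def
  by (auto simp: refl_on_def sym_def trans_def act_closed)

lemma smod_congruence_generated:
  assumes "R \<subseteq> carrier M \<times> carrier M"
  shows "smod_congruence \<Gamma> T M (generated_congruence \<Gamma> T M R)"
  unfolding generated_congruence_def
  using assms smod_congruence_full by (intro smod_congruence_Inter) auto

end

text \<open>The quotient and its universal property are developed for an arbitrary congruence
  \<open>r\<close>; the generated one is substituted only in the final theorem. Inherited facts with
  prefix \<open>M\<close> speak here of the monoid \<open>N\<close>.\<close>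

locale smod_quotient = ternary_gamma_semimodule \<Gamma> T N
  for \<Gamma> :: "'g monoid" and T :: "('t, 'g) tg_semiring" and N :: "('t, 'g, 'n) tg_semimodule" +
  fixes r :: "('n \<times> 'n) set"
  assumes cong: "smod_congruence \<Gamma> T N r"
begin

abbreviation Q where "Q \<equiv> quotient_smod N r"

lemma equiv: "equiv (carrier N) r"
  using cong by (rule smod_congruence_equiv)

lemma cong_add:
  assumes "(x, x') \<in> r" "(y, y') \<in> r"
  shows "(x \<boxplus>\<^bsub>N\<^esub> y, x' \<boxplus>\<^bsub>N\<^esub> y') \<in> r"
proof -
  have c: "x \<in> carrier N" "x' \<in> carrier N" "y \<in> carrier N" "y' \<in> carrier N"
    using assms equiv_type[OF equiv] by auto
  have "(x \<boxplus>\<^bsub>N\<^esub> y, x' \<boxplus>\<^bsub>N\<^esub> y) \<in> r"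
    using smod_congruence_add[OF cong assms(1)] c by simp
  moreover have "(x' \<boxplus>\<^bsub>N\<^esub> y, x' \<boxplus>\<^bsub>N\<^esub> y') \<in> r"
    using smod_congruence_add[OF cong assms(2), of x'] c by (simp add: M.m_comm)
  ultimately show ?thesis
    using equiv by (meson equiv_def transD)
qed

text \<open>Presents each class by a representative. With the rules for sum, action and zero that
  follow, statements about \<open>Q\<close> reduce to statements about elements of
  \<open>N\<close>.\<close>

lemma carrier_quotient: "carrier Q = (\<lambda>x. r `` {x}) ` carrier N"
  by (auto simp: quotient_smod_def quotient_def)

lemma add_quotient:
  assumes "x \<in> carrier N" "y \<in> carrier N"
  shows "r `` {x} \<boxplus>\<^bsub>Q\<^esub> r `` {y} = r `` {x \<boxplus>\<^bsub>N\<^esub> y}"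
proof -
  have "r `` {x' \<boxplus>\<^bsub>N\<^esub> y'} = r `` {x \<boxplus>\<^bsub>N\<^esub> y}" if "x' \<in> r `` {x}" "y' \<in> r `` {y}" for x' y'
    using equiv_class_eq[OF equiv cong_add[of x x' y y']] that by simp
  \<comment> \<open>All sets in the union coincide. The classes are nonempty, as \<open>x\<close>
    and \<open>y\<close> lie in their own classes, so the union is this common set.\<close>
  then have "(\<Union>x'\<in>r `` {x}. \<Union>y'\<in>r `` {y}. r `` {x' \<boxplus>\<^bsub>N\<^esub> y'}) = r `` {x \<boxplus>\<^bsub>N\<^esub> y}"
    using assms by (intro UN_constant_eq[of x] UN_constant_eq[of y] ballI equiv_class_self[OF equiv])
  then show ?thesis
    by (simp add: quotient_smod_def)
qed

lemma act_quotient: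
  assumes "a \<in> carrier T" "\<alpha> \<in> carrier \<Gamma>" "x \<in> carrier N" "\<beta> \<in> carrier \<Gamma>" "b \<in> carrier T"
  shows "act Q a \<alpha> (r `` {x}) \<beta> b = r `` {act N a \<alpha> x \<beta> b}"
proof -
  have "r `` {act N a \<alpha> x' \<beta> b} = r `` {act N a \<alpha> x \<beta> b}" if "x' \<in> r `` {x}" for x'
    using equiv_class_eq[OF equiv smod_congruence_act[OF cong, of x x' a \<alpha> \<beta> b]] that assms by simp
  then have "(\<Union>x'\<in>r `` {x}. r `` {act N a \<alpha> x' \<beta> b}) = r `` {act N a \<alpha> x \<beta> b}"
    using assms by (intro UN_constant_eq[of x] ballI equiv_class_self[OF equiv])
  then show ?thesis
    by (simp add: quotient_smod_def)
qed

lemma zero_quotient: "\<zero>\<^sub>m\<^bsub>Q\<^esub> = r `` {\<zero>\<^sub>m\<^bsub>N\<^esub>}"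
  by (simp add: quotient_smod_def)

text \<open>Closure and the identities descend from \<open>N\<close> by computing with
  representatives. Only the zero law is treated separately, because its hypothesis on
  \<open>X\<close> concerns a class and not a representative.\<close>

lemma quotient_semimodule: "ternary_gamma_semimodule \<Gamma> T Q"
proof -
  note q = carrier_quotient add_quotient act_quotient zero_quotient
  have "comm_monoid Q"
    by (rule comm_monoidI) (auto simp: q M.m_ac)
  moreover have "act Q a \<alpha> X \<beta> b = \<zero>\<^sub>m\<^bsub>Q\<^esub>"
    if c: "a \<in> carrier T" "\<alpha> \<in> carrier \<Gamma>" "X \<in> carrier Q" "\<beta> \<in> carrier \<Gamma>" "b \<in> carrier T"
      and z: "a = \<zero>\<^sub>m\<^bsub>T\<^esub> \<or> X = \<zero>\<^sub>m\<^bsub>Q\<^esub> \<or> b = \<zero>\<^sub>m\<^bsub>T\<^esub> \<or> \<alpha> = \<zero>\<^sub>m\<^bsub>\<Gamma>\<^esub> \<or> \<beta> = \<zero>\<^sub>m\<^bsub>\<Gamma>\<^esub>"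
    for a \<alpha> X \<beta> b
  proof -
    \<comment> \<open>A representative of the zero class need not be zero in \<open>N\<close>.
      Choosing \<open>x\<close> to be zero in that case makes \<open>act_zero\<close> of
      \<open>N\<close> applicable.\<close>
    obtain x where x: "x \<in> carrier N" "X = r `` {x}" "X = \<zero>\<^sub>m\<^bsub>Q\<^esub> \<Longrightarrow> x = \<zero>\<^sub>m\<^bsub>N\<^esub>"
      using c(3) zero_quotient M.one_closed by (cases "X = \<zero>\<^sub>m\<^bsub>Q\<^esub>") (auto simp: carrier_quotient)
    then have "act N a \<alpha> x \<beta> b = \<zero>\<^sub>m\<^bsub>N\<^esub>"
      using c z by (intro act_zero) auto
    then show ?thesis
      using c x by (simp add: q)
  qed
  ultimately show ?thesis
    by (intro ternary_gamma_semimodule.intro ternary_gamma_semimodule_axioms.intro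
        ternary_gamma_semiring_axioms)
      (auto simp: q act_closed act_add1 act_add2 act_add3 act_add4 act_add5 act_assoc tern_closed)
qed

lemma quotient_proj_hom: "quotient_proj N r \<in> smod_hom \<Gamma> T N Q"
  by (rule smod_homI)
    (auto simp: quotient_proj_def carrier_quotient add_quotient act_quotient zero_quotient act_closed)

lemma quotient_proj_eq:
  assumes "(x, y) \<in> r"
  shows "quotient_proj N r x = quotient_proj N r y"
  using equiv_class_eq[OF equiv assms] assms equiv_type[OF equiv]
  by (auto simp: quotient_proj_def)

lemma quotient_proj_onto: "quotient_proj N r ` carrier N = carrier Q"
  by (auto simp: quotient_proj_def carrier_quotient)

text \<open>A map constant on classes descends to \<open>Q\<close>, and being a morphism is checked
  on representatives.\<close>

lemma quotient_factorization:
  assumes h: "h \<in> smod_hom \<Gamma> T N P"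
    and resp: "\<And>x y. (x, y) \<in> r \<Longrightarrow> h x = h y"
  shows "\<exists>!u. u \<in> smod_hom \<Gamma> T Q P \<and> compose (carrier N) u (quotient_proj N r) = h"
proof (rule ex_ex1I)
  \<comment> \<open>The chosen element of the class of \<open>x\<close> is related to
    \<open>x\<close>, so \<open>resp\<close> makes the value \<open>h x\<close> whatever the choice.
    Restricting to \<open>carrier Q\<close> puts \<open>u\<close> in the extensional function
    space.\<close>
  define u where "u = (\<lambda>X\<in>carrier Q. h (SOME x. x \<in> X))"
  have u: "u (r `` {x}) = h x" if "x \<in> carrier N" for x
  proof -
    have "x \<in> r `` {x}"
      using that equiv_class_self[OF equiv] by auto
    then have "(SOME z. z \<in> r `` {x}) \<in> r `` {x}"
      by (rule someI)
    then show ?thesis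
      using that resp[of x] by (auto simp: u_def carrier_quotient)
  qed
  have "u \<in> smod_hom \<Gamma> T Q P"
  proof (rule smod_homI)
    show "u \<in> extensional (carrier Q)"
      by (simp add: u_def)
  qed (auto simp: carrier_quotient add_quotient act_quotient zero_quotient u act_closed
      smod_homD[OF h])
  moreover have "compose (carrier N) u (quotient_proj N r) = h"
    using smod_hom_ext[OF h]
    by (intro extensionalityI[of _ "carrier N"]) (auto simp: compose_def quotient_proj_def u)
  ultimately show "\<exists>u. u \<in> smod_hom \<Gamma> T Q P \<and> compose (carrier N) u (quotient_proj N r) = h"
    by blast
next
  fix u v
  assume u: "u \<in> smod_hom \<Gamma> T Q P \<and> compose (carrier N) u (quotient_proj N r) = h"
    and v: "v \<in> smod_hom \<Gamma> T Q P \<and> compose (carrier N) v (quotient_proj N r) = h"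
  show "u = v"
  \<comment> \<open>Extensionality settles all arguments outside \<open>carrier Q\<close>; inside,
    each class is a value of the projection, where both maps are determined by
    \<open>h\<close>.\<close>
  proof (rule extensionalityI)
    show "u \<in> extensional (carrier Q)" "v \<in> extensional (carrier Q)"
      using u v smod_hom_ext by blast+
    fix X assume "X \<in> carrier Q"
    then obtain x where x: "x \<in> carrier N" "X = quotient_proj N r x"
      using quotient_proj_onto by blast
    then show "u X = v X"
      using u v by (metis compose_eq)
  qed
qed

end

theorem proposition5p2:
  fixes \<Gamma> :: "'g monoid" and T :: "('t, 'g) tg_semiring"
    and M :: "('t, 'g, 'm) tg_semimodule" and N :: "('t, 'g, 'n) tg_semimodule"
    and f g :: "'m \<Rightarrow> 'n"
  assumes "ternary_gamma_semiring \<Gamma> T"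
    and "ternary_gamma_semimodule \<Gamma> T M"
    and "ternary_gamma_semimodule \<Gamma> T N"
    and "f \<in> smod_hom \<Gamma> T M N"
    and "g \<in> smod_hom \<Gamma> T M N"
  defines "r \<equiv> generated_congruence \<Gamma> T N {(f m, g m) | m. m \<in> carrier M}"
  shows "is_coequalizer TYPE('p) \<Gamma> T M N f g (quotient_smod N r) (quotient_proj N r)"
proof -
  interpret N: ternary_gamma_semimodule \<Gamma> T N by fact
  let ?R = "{(f m, g m) | m. m \<in> carrier M}"
  note cl = smod_hom_closed[OF assms(4)] smod_hom_closed[OF assms(5)]
  \<comment> \<open>Since \<open>f\<close> and \<open>g\<close> take values in
    \<open>carrier N\<close>, the generating pairs form a relation on that carrier, so
    \<open>r\<close> is a congruence.\<close>
  interpret smod_quotient \<Gamma> T N r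
    by unfold_locales (unfold r_def, rule N.smod_congruence_generated, auto simp: cl)
  have "quotient_proj N r (f m) = quotient_proj N r (g m)" if "m \<in> carrier M" for m
    using that generated_congruence_superset[of ?R \<Gamma> T N]
    by (intro quotient_proj_eq) (auto simp: r_def)
  then have "compose (carrier M) (quotient_proj N r) f = compose (carrier M) (quotient_proj N r) g"
    by (auto simp: compose_def intro: restrict_ext)
  moreover have "\<exists>!u. u \<in> smod_hom \<Gamma> T Q P \<and> compose (carrier N) u (quotient_proj N r) = h"
    if h: "h \<in> smod_hom \<Gamma> T N P" and hfg: "compose (carrier M) h f = compose (carrier M) h g"
    for P :: "('t, 'g, 'p) tg_semimodule" and h
  proof (rule quotient_factorization[OF h])
    have "h (f m) = h (g m)" if "m \<in> carrier M" for m
      using hfg that by (metis compose_eq)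
    \<comment> \<open>Minimality of \<open>r\<close> is used here: it turns equality on the
      generating pairs into equality on all of \<open>r\<close>.\<close>
    then have "r \<subseteq> {(x, y). x \<in> carrier N \<and> y \<in> carrier N \<and> h x = h y}"
      unfolding r_def
      by (intro generated_congruence_least N.smod_congruence_kernel[OF h]) (auto simp: cl)
    then show "h x = h y" if "(x, y) \<in> r" for x y
      using that by auto
  qed
  ultimately show ?thesis
    unfolding is_coequalizer_def using quotient_semimodule quotient_proj_hom by blast
qed

end
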